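(* Let $n\ge 2$. The graphs $\mathrm{Cay}(\mathbf{F}_n,\mathcal{C}^{\mathrm{sep}})$ and $\mathrm{Cay}(\mathbf{F}_n,\mathcal{C}^{\mathrm{prim}})$ have infinite diameter.
   Context: $\mathbf{F}_n$ is the free group of rank $n$. A proper free factor of $\mathbf{F}_n$ is a nontrivial proper subgroup $F$ such that $\mathbf{F}_n=F*G$ for some nontrivial proper subgroup $G$. $\mathcal{C}^{\mathrm{sep}}$ is the set of elements of $\mathbf{F}_n$ lying in some proper free factor (separable elements), and $\mathcal{C}^{\mathrm{prim}}$ is the set of all primitive elements of $\mathbf{F}_n$ (elements belonging to some basis). For a group $G$ and a subset $S\subseteq G$, the Cayley graph $\mathrm{Cay}(G,S)$ is the directed graph with vertex set $G$ and an edge labeled $s\in S$ from $v$ to $w$ whenever $vs=w$ in $G$; it carries the path metric (ignoring orientations) with each edge of length one. *)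

theory Defs
  imports
    "HOL-Algebra.Generated_Groups"
    "Graph_Theory.Digraph_Component"
    "Graph_Theory.Shortest_Path"
begin

section \<open>Free groups and their bases\<close>

definition group_prod :: "('a, 'm) monoid_scheme \<Rightarrow> 'a list \<Rightarrow> 'a" where
  "group_prod G xs = foldr (\<otimes>\<^bsub>G\<^esub>) xs \<one>\<^bsub>G\<^esub>"

text \<open>A word is a list of letters \<open>(e, x)\<close>; the letter \<open>(True, x)\<close> stands for \<open>x\<close> and \<open>(False, x)\<close>
  for the inverse of \<open>x\<close>.\<close>

definition word_value :: "('a, 'm) monoid_scheme \<Rightarrow> (bool \<times> 'a) list \<Rightarrow> 'a" where
  "word_value G w = group_prod G (map (\<lambda>(e, x). if e then x else inv\<^bsub>G\<^esub> x) w)"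

definition reduced_word :: "(bool \<times> 'a) list \<Rightarrow> bool" where
  "reduced_word w \<longleftrightarrow> successively (\<lambda>(d, x) (e, y). x = y \<longrightarrow> d = e) w"

definition free_basis :: "('a, 'm) monoid_scheme \<Rightarrow> 'a set \<Rightarrow> bool" where
  "free_basis G B \<longleftrightarrow>
     B \<subseteq> carrier G \<and> generate G B = carrier G \<and>
     (\<forall>w. w \<noteq> [] \<and> set w \<subseteq> UNIV \<times> B \<and> reduced_word w \<longrightarrow> word_value G w \<noteq> \<one>\<^bsub>G\<^esub>)"

definition free_group_of_rank :: "('a, 'm) monoid_scheme \<Rightarrow> nat \<Rightarrow> bool" where
  "free_group_of_rank G n \<longleftrightarrow> group G \<and> (\<exists>B. free_basis G B \<and> finite B \<and> card B = n)"

definition primitive_elements :: "('a, 'm) monoid_scheme \<Rightarrow> 'a set" where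
  "primitive_elements G = {x. \<exists>B. free_basis G B \<and> x \<in> B}"

section \<open>Free factors and separable elements\<close>

text \<open>\<open>G\<close> is the internal free product of the subgroups \<open>H\<close> and \<open>K\<close>: they generate \<open>G\<close>, and no
  nonempty alternating product of nontrivial elements of \<open>H\<close> and \<open>K\<close> is trivial.
  For \<open>z \<in> H \<inter> K\<close> the list \<open>[z, inv z]\<close> counts as alternating, which forces
  \<open>H \<inter> K\<close> to be trivial.\<close>

definition is_free_product :: "('a, 'm) monoid_scheme \<Rightarrow> 'a set \<Rightarrow> 'a set \<Rightarrow> bool" where
  "is_free_product G H K \<longleftrightarrow>
     subgroup H G \<and> subgroup K G \<and> generate G (H \<union> K) = carrier G \<and>
     (\<forall>xs. xs \<noteq> [] \<and> set xs \<subseteq> (H \<union> K) - {\<one>\<^bsub>G\<^esub>} \<and>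
           successively (\<lambda>x y. x \<in> H \<and> y \<in> K \<or> x \<in> K \<and> y \<in> H) xs \<longrightarrow>
           group_prod G xs \<noteq> \<one>\<^bsub>G\<^esub>)"

definition proper_nontrivial_subgroup :: "('a, 'm) monoid_scheme \<Rightarrow> 'a set \<Rightarrow> bool" where
  "proper_nontrivial_subgroup G H \<longleftrightarrow> subgroup H G \<and> H \<noteq> {\<one>\<^bsub>G\<^esub>} \<and> H \<noteq> carrier G"

definition proper_free_factor :: "('a, 'm) monoid_scheme \<Rightarrow> 'a set \<Rightarrow> bool" where
  "proper_free_factor G H \<longleftrightarrow>
     proper_nontrivial_subgroup G H \<and>
     (\<exists>K. proper_nontrivial_subgroup G K \<and> is_free_product G H K)"

definition separable_elements :: "('a, 'm) monoid_scheme \<Rightarrow> 'a set" where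
  "separable_elements G = \<Union>{H. proper_free_factor G H}"

section \<open>Cayley graphs and diameter\<close>

text \<open>The arc \<open>(v, s)\<close> is the edge labelled \<open>s\<close> that leaves \<open>v\<close>.\<close>

definition Cay :: "('a, 'm) monoid_scheme \<Rightarrow> 'a set \<Rightarrow> ('a, 'a \<times> 'a) pre_digraph" where
  "Cay G S = \<lparr>verts = carrier G, arcs = carrier G \<times> S,
              tail = fst, head = (\<lambda>(v, s). v \<otimes>\<^bsub>G\<^esub> s)\<rparr>"

lemma wf_digraph_Cay:
  assumes "group G" "S \<subseteq> carrier G"
  shows "wf_digraph (Cay G S)"
  using assms by unfold_locales (auto simp: Cay_def group.is_monoid intro!: monoid.m_closed)

lemma primitive_elements_subset: "primitive_elements G \<subseteq> carrier G"
  by (auto simp: primitive_elements_def free_basis_def)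

lemma separable_elements_subset: "separable_elements G \<subseteq> carrier G"
  by (auto simp: separable_elements_def proper_free_factor_def proper_nontrivial_subgroup_def
      dest: subgroup.subset)

text \<open>Path metric with edges of length one, orientations being ignored; the distance of two vertices
  in different components is \<open>\<infinity>\<close>. The library constant \<open>\<mu>\<close> is specified for well-formed digraphs, and
  the symmetrization of a well-formed digraph is well-formed.\<close>

definition path_dist :: "('a, 'b) pre_digraph \<Rightarrow> 'a \<Rightarrow> 'a \<Rightarrow> ereal" where
  "path_dist D u v = wf_digraph.\<mu> (with_proj (mk_symmetric D)) (\<lambda>_. 1) u v"

lemma path_dist_eq:
  assumes "wf_digraph D"
  shows "path_dist D u v =
    (INF p\<in>{p. pre_digraph.awalk (with_proj (mk_symmetric D)) u p v}. ereal (real (length p)))"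
proof -
  interpret wf_digraph D by fact
  interpret S: pair_wf_digraph "mk_symmetric D" ..
  show ?thesis by (simp add: path_dist_def S.\<mu>_def S.awalk_cost_def sum_list_triv)
qed

definition graph_diameter :: "('a, 'b) pre_digraph \<Rightarrow> ereal" where
  "graph_diameter D = (SUP u\<in>verts D. SUP v\<in>verts D. path_dist D u v)"

end

theory Submission
  imports Defs
begin

text \<open>Let \<open>u\<close> be a cyclically reduced word that contains all reduced words of length two. The
  Brooks counting function of \<open>u\<close>, the number of occurrences of \<open>u\<close> minus that of \<open>u\<^sup>-\<^sup>1\<close> in the
  reduced form of an element, is a quasimorphism that is unbounded on the powers of \<open>u\<close>. It is
  bounded on separable elements, hence Lipschitz on the Cayley graph: writing such an element as
  \<open>c w c\<^sup>-\<^sup>1\<close> with \<open>w\<close> cyclically reduced, the contributions of \<open>c\<close> and \<open>c\<^sup>-\<^sup>1\<close> cancel, and \<open>w\<close> contains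
  neither \<open>u\<close> nor \<open>u\<^sup>-\<^sup>1\<close> because some reduced word of length two is missing from it.

  This last fact is a weak form of Whitehead's cut vertex lemma. If \<open>F = H * K\<close>, the set \<open>A\<close> of
  elements whose normal form starts in \<open>K\<close> satisfies \<open>A H = A\<close> and has finite coboundary in the
  Cayley tree of a finite basis. Among the reduced words \<open>p\<close> such that the branch of the tree
  beyond \<open>p\<close> meets both \<open>A\<close> and its complement in infinite sets, take a longest one. Then there are letters
  \<open>a \<noteq> b\<close> such that the branch beyond \<open>p a\<close> is almost disjoint from \<open>A\<close> and the branch beyond \<open>p b\<close> is
  almost contained in \<open>A\<close>. If \<open>a\<^sup>-\<^sup>1 b\<close> occurred in the cyclically reduced core of an element of \<open>H\<close>,
  some translate of its axis would run from one branch to the other, contradicting \<open>A H = A\<close>.\<close>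

section \<open>Reduced words\<close>

definition flip_letter :: "bool \<times> 'a \<Rightarrow> bool \<times> 'a" where
  "flip_letter = map_prod Not id"

definition inv_word :: "(bool \<times> 'a) list \<Rightarrow> (bool \<times> 'a) list" where
  "inv_word w = rev (map flip_letter w)"

lemma flip_letter_flip [simp]: "flip_letter (flip_letter x) = x"
  by (cases x) (simp add: flip_letter_def)

lemma flip_letter_neq [simp]: "flip_letter x \<noteq> x" "x \<noteq> flip_letter x"
  by (cases x, simp add: flip_letter_def)+

lemma flip_letter_inject [simp]: "flip_letter x = flip_letter y \<longleftrightarrow> x = y"
  by (metis flip_letter_flip)

lemma snd_flip_letter [simp]: "snd (flip_letter x) = snd x"
  by (simp add: flip_letter_def)

lemma flip_letter_mem_iff [simp]: "flip_letter x \<in> UNIV \<times> B \<longleftrightarrow> x \<in> UNIV \<times> B"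
  by (simp add: mem_Times_iff)

lemma inv_word_Nil [simp]: "inv_word [] = []"
  and inv_word_Cons [simp]: "inv_word (x # w) = inv_word w @ [flip_letter x]"
  and inv_word_append [simp]: "inv_word (v @ w) = inv_word w @ inv_word v"
  and length_inv_word [simp]: "length (inv_word w) = length w"
  and inv_word_eq_Nil_iff [simp]: "inv_word w = [] \<longleftrightarrow> w = []"
  by (simp_all add: inv_word_def)

lemma inv_word_inv_word [simp]: "inv_word (inv_word w) = w"
  by (induction w) auto

lemma inv_word_eq_iff: "inv_word v = w \<longleftrightarrow> v = inv_word w"
  by auto

lemma set_inv_word_subset_iff [simp]: "set (inv_word w) \<subseteq> UNIV \<times> B \<longleftrightarrow> set w \<subseteq> UNIV \<times> B"
  by (induction w) auto

lemma reduced_word_alt: "reduced_word w \<longleftrightarrow> successively (\<lambda>x y. y \<noteq> flip_letter x) w"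
  unfolding reduced_word_def by (intro successively_cong refl) (auto simp: flip_letter_def)

lemma reduced_word_Nil [simp]: "reduced_word []"
  and reduced_word_single [simp]: "reduced_word [x]"
  and reduced_word_Cons:
    "reduced_word (x # w) \<longleftrightarrow> w = [] \<or> hd w \<noteq> flip_letter x \<and> reduced_word w"
  and reduced_word_append:
    "reduced_word (v @ w) \<longleftrightarrow>
       reduced_word v \<and> reduced_word w \<and> (v = [] \<or> w = [] \<or> hd w \<noteq> flip_letter (last v))"
  by (auto simp: reduced_word_alt successively_Cons successively_append_iff)

lemma reduced_inv_word [simp]: "reduced_word (inv_word w) \<longleftrightarrow> reduced_word w"
  unfolding reduced_word_alt inv_word_def successively_rev successively_map
  by (intro successively_cong refl) auto

text \<open>Free cancellation in the product of \<open>v\<close> and \<open>w\<close>: letters are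
  stripped from the end of \<open>v\<close> while the front of \<open>w\<close> is inverse to them,
  and \<open>b\<close> collects what cancels.\<close>

lemma reduced_word_cancel:
  assumes "reduced_word v" "reduced_word w"
  obtains a b c where "v = a @ b" "w = inv_word b @ c" "reduced_word (a @ c)"
proof -
  have "\<exists>a b c. v = a @ b \<and> w = inv_word b @ c \<and> reduced_word (a @ c)"
    using assms
  proof (induction v arbitrary: w rule: rev_induct)
    case (snoc x v)
    show ?case
    proof (cases "w \<noteq> [] \<and> hd w = flip_letter x")
      case True
      then obtain w' where w': "w = flip_letter x # w'" by (cases w) auto
      with snoc.prems have "reduced_word v" "reduced_word w'"
        by (auto simp: reduced_word_append reduced_word_Cons)
      with snoc.IH obtain a b c where "v = a @ b" "w' = inv_word b @ c" "reduced_word (a @ c)"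
        by blast
      with w' show ?thesis by (intro exI[of _ a] exI[of _ "b @ [x]"] exI[of _ c]) auto
    next
      case False
      with snoc.prems have "reduced_word ((v @ [x]) @ w)"
        by (auto simp: reduced_word_append reduced_word_Cons)
      then have "v @ [x] = (v @ [x]) @ [] \<and> w = inv_word [] @ w \<and> reduced_word ((v @ [x]) @ w)"
        by simp
      then show ?thesis by blast
    qed
  qed auto
  with that show ?thesis by blast
qed

text \<open>As long as the first and last letters are inverse to each other, both move into the
  conjugator \<open>c\<close>. Reducedness of \<open>w0 @ w0\<close> encodes that \<open>w0\<close>
  is cyclically reduced.\<close>

lemma reduced_word_cyclic_core:
  assumes "reduced_word w"
  obtains c w0 where "w = c @ w0 @ inv_word c" "reduced_word (w0 @ w0)"
proof -
  have "\<exists>c w0. w = c @ w0 @ inv_word c \<and> reduced_word (w0 @ w0)"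
    using assms
  proof (induction w rule: length_induct)
    case (1 w)
    show ?case
    proof (cases "reduced_word (w @ w)")
      case True
      then show ?thesis by (intro exI[of _ "[]"] exI[of _ w]) auto
    next
      case False
      with 1 have *: "w \<noteq> []" "hd w = flip_letter (last w)" by (auto simp: reduced_word_append)
      then obtain x v where xv: "w = x # v" by (cases w) auto
      with * have "v \<noteq> []" by auto
      then obtain w' y where "v = w' @ [y]" by (cases v rule: rev_cases) auto
      with xv * have w: "w = x # w' @ [flip_letter x]" by auto
      with "1.prems" have "reduced_word w'" by (auto simp: reduced_word_append reduced_word_Cons)
      moreover have "length w' < length w" using w by simp
      ultimately obtain c w0 where "w' = c @ w0 @ inv_word c" "reduced_word (w0 @ w0)"
        using "1.IH" by blast
      with w show ?thesis by (intro exI[of _ "x # c"] exI[of _ w0]) auto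
    qed
  qed
  with that show ?thesis by blast
qed

section \<open>Powers of cyclically reduced words\<close>

abbreviation word_power :: "nat \<Rightarrow> 'b list \<Rightarrow> 'b list" where
  "word_power m w \<equiv> concat (replicate m w)"

lemma word_power_Suc_right: "word_power (Suc m) w = word_power m w @ w"
  by (induction m) auto

lemma length_word_power: "length (word_power m w) = m * length w"
  by (induction m) auto

lemma set_word_power_subset: "set w \<subseteq> S \<Longrightarrow> set (word_power m w) \<subseteq> S"
  by (induction m) auto

lemma reduced_word_power:
  assumes "reduced_word (w @ w)"
  shows "reduced_word (word_power m w)"
proof (induction m)
  case (Suc m)
  have "hd (word_power m w) = hd w" if "w \<noteq> []" "m \<noteq> 0"
    using that by (cases m) auto
  with Suc assms show ?case
    by (cases "m = 0") (auto simp: reduced_word_append)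
qed auto

text \<open>This is the absence of involutions in a free group. The outer letters of such a word are
  inverse to each other and the middle is again its own inverse, hence empty by induction; the outer
  letters would then cancel. A middle of one letter is impossible because no letter is its own
  inverse.\<close>

lemma reduced_self_inverse:
  assumes "reduced_word t" "inv_word t = t"
  shows "t = []"
  using assms
proof (induction t rule: length_induct)
  case (1 t)
  show ?case
  proof (cases t)
    case (Cons x v)
    have "v \<noteq> []" using 1 Cons by auto
    then obtain w y where v: "v = w @ [y]" by (cases v rule: rev_cases) auto
    with Cons 1 have "inv_word w = w" "y = flip_letter x" by auto
    moreover from this v Cons 1 have "w = []"
      by (auto simp: reduced_word_append reduced_word_Cons)
    ultimately show ?thesis using 1 v Cons by (auto simp: reduced_word_Cons)
  qed auto
qed

text \<open>A window of length \<open>length u\<close> in a word of period \<open>u\<close> is a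
  cyclic rotation of \<open>u\<close>. The induction drops copies of \<open>u\<close> until the
  window starts inside the first one.\<close>

lemma word_power_window:
  assumes "word_power m u = v @ x @ z" "length x = length u"
  obtains s t where "u = s @ t" "x = t @ s"
proof -
  have "\<exists>s t. u = s @ t \<and> x = t @ s"
    using assms
  proof (induction m arbitrary: v)
    case (Suc m)
    have eq: "u @ word_power m u = v @ x @ z" using Suc.prems by simp
    show ?case
    proof (cases "length v \<ge> length u")
      case True
      with eq obtain v' where "v = u @ v'" by (auto simp: append_eq_append_conv2)
      with eq Suc show ?thesis by auto
    next
      case False
      with eq obtain t where t: "u = v @ t" by (auto simp: append_eq_append_conv2)
      with eq have xz: "x @ z = t @ word_power m u" by auto
      show ?thesis
      proof (cases m)
        case 0
        with xz have "length x + length z = length t" by (metis append_Nil2 concat.simps(1) length_append replicate_0)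
        with t Suc.prems have "v = []" by auto
        moreover from this xz 0 t Suc.prems have "x = t" by auto
        ultimately show ?thesis using t by auto
      next
        case (Suc k)
        with xz t have "x @ z = (t @ v) @ t @ word_power k u" by auto
        moreover have "length x = length (t @ v)" using t \<open>length x = length u\<close> by auto
        ultimately have "x = t @ v" by (metis append_eq_append_conv)
        with t show ?thesis by auto
      qed
    qed
  qed auto
  with that show ?thesis by blast
qed

text \<open>Otherwise \<open>inv_word u\<close> is a rotation \<open>t @ s\<close> of
  \<open>u = s @ t\<close>. Comparing lengths, \<open>s\<close> and \<open>t\<close> are their own
  inverses, hence empty. Thus the negative count in the Brooks function vanishes on powers of
  \<open>u\<close>.\<close>

lemma inv_word_not_in_word_power:
  assumes "reduced_word u" "u \<noteq> []"
  shows "word_power m u \<noteq> v @ inv_word u @ z"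
proof
  assume "word_power m u = v @ inv_word u @ z"
  then obtain s t where st: "u = s @ t" "inv_word u = t @ s"
    by (rule word_power_window) auto
  then have "inv_word t = t" "inv_word s = s"
    by auto
  moreover have "reduced_word t" "reduced_word s"
    using assms st by (auto simp: reduced_word_append)
  ultimately show False using reduced_self_inverse st assms by blast
qed

text \<open>The three letters \<open>(True, b)\<close>, \<open>(False, b)\<close>,
  \<open>(True, c)\<close> are distinct, and each of the two neighbours forbids at most one of
  them.\<close>

lemma reduced_word_join:
  assumes "reduced_word v" "reduced_word w" "b \<in> B" "c \<in> B" "b \<noteq> c"
  obtains z where "z \<in> UNIV \<times> B" "reduced_word (v @ z # w)"
proof -
  have "\<exists>z\<in>{(True, b), (False, b), (True, c)}. z \<noteq> flip_letter x \<and> y \<noteq> flip_letter z" for x y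
    using assms by (cases x; cases y) (auto simp: flip_letter_def)
  then obtain z where "z\<in>{(True, b), (False, b), (True, c)}"
    "z \<noteq> flip_letter (last v)" "hd w \<noteq> flip_letter z" by blast
  with assms that[of z] show ?thesis by (auto simp: reduced_word_append reduced_word_Cons)
qed

text \<open>The words of \<open>T\<close> are strung together with linking letters from
  \<open>reduced_word_join\<close>.\<close>

lemma ex_reduced_word_containing:
  assumes "finite T" "\<And>t. t \<in> T \<Longrightarrow> reduced_word t \<and> set t \<subseteq> UNIV \<times> B"
    and bc: "b \<in> B" "c \<in> B" "b \<noteq> c"
  obtains u where "u \<noteq> []" "reduced_word (u @ u)" "set u \<subseteq> UNIV \<times> B"
    "\<And>t. t \<in> T \<Longrightarrow> \<exists>v z. u = v @ t @ z"
proof -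
  have "\<exists>u. reduced_word u \<and> set u \<subseteq> UNIV \<times> B \<and> (\<forall>t\<in>T. \<exists>v z. u = v @ t @ z)"
    using assms(1,2)
  proof (induction T)
    case (insert t T)
    then obtain u where u: "reduced_word u" "set u \<subseteq> UNIV \<times> B" "\<forall>t\<in>T. \<exists>v z. u = v @ t @ z"
      by auto
    from insert have t: "reduced_word t" "set t \<subseteq> UNIV \<times> B" by auto
    obtain z where z: "z \<in> UNIV \<times> B" "reduced_word (u @ z # t)"
      using reduced_word_join[OF u(1) t(1) bc] .
    have "\<exists>v y. u @ z # t = v @ s @ y" if "s \<in> insert t T" for s
    proof (cases "s = t")
      case True
      then show ?thesis by (intro exI[of _ "u @ [z]"] exI[of _ "[]"]) auto
    next
      case False
      with that u(3) obtain v y where "u = v @ s @ y" by auto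
      then show ?thesis by (intro exI[of _ v] exI[of _ "y @ z # t"]) auto
    qed
    with u t z show ?case by (intro exI[of _ "u @ z # t"]) auto
  qed (auto intro: exI[of _ "[]"])
  then obtain u where u: "reduced_word u" "set u \<subseteq> UNIV \<times> B" "\<forall>t\<in>T. \<exists>v z. u = v @ t @ z"
    by blast
  \<comment> \<open>A last linking letter between \<open>u\<close> and itself makes
    \<open>u @ [z]\<close> cyclically reduced.\<close>
  obtain z where z: "z \<in> UNIV \<times> B" "reduced_word (u @ z # u)"
    using reduced_word_join[OF u(1) u(1) bc] .
  show ?thesis
  proof (rule that[of "u @ [z]"])
    show "reduced_word ((u @ [z]) @ u @ [z])"
      using z(2) reduced_word_append[of "u @ [z]" u] reduced_word_append[of "u @ [z]" "u @ [z]"]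
      by (cases "u = []") auto
    show "\<exists>v y. u @ [z] = v @ t @ y" if "t \<in> T" for t
      using u(3) that by (metis append.assoc)
  qed (use u z in auto)
qed

section \<open>Counting subwords\<close>

primrec occurrences :: "'b list \<Rightarrow> 'b list \<Rightarrow> nat" where
  "occurrences u [] = 0"
| "occurrences u (x # w) = (if \<exists>z. x # w = u @ z then 1 else 0) + occurrences u w"

lemma occurrences_append_ge: "occurrences u v + occurrences u w \<le> occurrences u (v @ w)"
proof (induction v)
  case (Cons x v)
  have "\<exists>z. x # v @ w = u @ z" if "\<exists>z. x # v = u @ z"
    using that by (metis append_Cons append_assoc)
  with Cons show ?case by auto
qed auto

lemma occurrences_append_le:
  "occurrences u (v @ w) \<le> occurrences u v + occurrences u w + length u"
proof -
  \<comment> \<open>An occurrence that straddles the junction starts among the last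
    \<open>length u\<close> letters of \<open>v\<close>. The minimum is what the induction carries:
    a new front letter can start a straddling occurrence only while \<open>v\<close> is shorter than
    \<open>u\<close>.\<close>
  have "occurrences u (v @ w) \<le> occurrences u v + occurrences u w + min (length v) (length u)"
  proof (induction v)
    case (Cons x v)
    have "\<exists>z. x # v = u @ z" if "\<exists>z. x # v @ w = u @ z" "length v \<ge> length u"
    proof -
      from that(1) obtain z where "(x # v) @ w = u @ z" by auto
      with that(2) show ?thesis by (auto simp: append_eq_append_conv2 simp del: append_Cons)
    qed
    with Cons show ?case by (auto simp: min_def split: if_splits)
  qed auto
  then show ?thesis by linarith
qed

text \<open>The recursion counts occurrences by where they start; here they are counted by where
  they end, as inversion turns prefixes into suffixes.\<close>

lemma occurrences_snoc:
  assumes "u \<noteq> []"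
  shows "occurrences u (w @ [x]) = occurrences u w + (if \<exists>v. w @ [x] = v @ u then 1 else 0)"
proof (induction w)
  case Nil
  have "(\<exists>z. [x] = u @ z) \<longleftrightarrow> (\<exists>v. [x] = v @ u)"
    using assms by (auto simp: Cons_eq_append_conv)
  then show ?case by auto
next
  case (Cons y w)
  have "(\<exists>v. y # w @ [x] = v @ u) \<longleftrightarrow> y # w @ [x] = u \<or> (\<exists>v. w @ [x] = v @ u)"
    by (auto simp: Cons_eq_append_conv)
  moreover have "(\<exists>z. y # w @ [x] = u @ z) \<longleftrightarrow> y # w @ [x] = u \<or> (\<exists>z. y # w = u @ z)"
  proof
    assume "\<exists>z. y # w @ [x] = u @ z"
    then obtain z where z: "(y # w) @ [x] = u @ z" by auto
    show "y # w @ [x] = u \<or> (\<exists>z. y # w = u @ z)"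
      using z by (cases z rule: rev_cases) (auto simp flip: append_assoc)
  next
    assume "y # w @ [x] = u \<or> (\<exists>z. y # w = u @ z)"
    then show "\<exists>z. y # w @ [x] = u @ z" by (metis append_Cons append_Nil2 append_assoc)
  qed
  moreover have "\<not> (\<exists>v. w @ [x] = v @ u)" "\<not> (\<exists>z. y # w = u @ z)" if "y # w @ [x] = u"
    using arg_cong[OF that, of length] by (auto dest!: arg_cong[where f = length])
  ultimately show ?case using Cons by auto
qed

lemma occurrences_inv_word:
  assumes "u \<noteq> []"
  shows "occurrences u (inv_word w) = occurrences (inv_word u) w"
proof (induction w)
  case (Cons x w)
  have "(\<exists>v. inv_word w @ [flip_letter x] = v @ u) \<longleftrightarrow> (\<exists>v. inv_word (x # w) = v @ u)"
    by simp
  also have "\<dots> \<longleftrightarrow> (\<exists>z. x # w = inv_word u @ z)"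
    unfolding inv_word_eq_iff by (metis inv_word_append inv_word_inv_word)
  finally show ?case using Cons occurrences_snoc[OF assms] by simp
qed auto

lemma occurrences_eq_0:
  assumes "\<And>v z. w \<noteq> v @ u @ z"
  shows "occurrences u w = 0"
  using assms
proof (induction w)
  case (Cons x w)
  have "w \<noteq> v @ u @ z" for v z
    using Cons.prems[of "x # v" z] by auto
  moreover have "\<nexists>z. x # w = u @ z" using Cons.prems[of "[]"] by auto
  ultimately show ?case using Cons.IH by auto
qed auto

lemma occurrences_word_power:
  assumes "u \<noteq> []"
  shows "occurrences u (word_power m u) \<ge> m"
proof (induction m)
  case (Suc m)
  have "occurrences u u \<ge> 1" using assms by (cases u) auto
  with Suc occurrences_append_ge[of u u "word_power m u"] show ?case by simp
qed auto


definition word_brooks :: "(bool \<times> 'a) list \<Rightarrow> (bool \<times> 'a) list \<Rightarrow> int" where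
  "word_brooks u w = int (occurrences u w) - int (occurrences (inv_word u) w)"

text \<open>Each of the two counts exceeds additivity by an amount between 0 and
  \<open>length u\<close>, so their difference is off by at most \<open>length u\<close>.\<close>

lemma word_brooks_append:
  "\<bar>word_brooks u (v @ w) - word_brooks u v - word_brooks u w\<bar> \<le> int (length u)"
  using occurrences_append_ge[of u v w] occurrences_append_le[of u v w]
    occurrences_append_ge[of "inv_word u" v w] occurrences_append_le[of "inv_word u" v w]
  by (simp add: word_brooks_def)

lemma word_brooks_inv_word:
  "u \<noteq> [] \<Longrightarrow> word_brooks u (inv_word w) = - word_brooks u w"
  by (simp add: word_brooks_def occurrences_inv_word)

section \<open>Normal forms in a free group\<close>

definition reduced_words :: "'a set \<Rightarrow> (bool \<times> 'a) list set" where
  "reduced_words C = {w. set w \<subseteq> UNIV \<times> C \<and> reduced_word w}"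

context group
begin

lemma mult_inv_cancel_left [simp]:
  assumes "x \<in> carrier G" "y \<in> carrier G"
  shows "x \<otimes> (inv x \<otimes> y) = y" "inv x \<otimes> (x \<otimes> y) = y"
  using assms by (simp_all flip: m_assoc)

lemma group_prod_Nil [simp]: "group_prod G [] = \<one>"
  and group_prod_Cons [simp]: "group_prod G (x # xs) = x \<otimes> group_prod G xs"
  by (simp_all add: group_prod_def)

lemma group_prod_closed [simp]: "set xs \<subseteq> carrier G \<Longrightarrow> group_prod G xs \<in> carrier G"
  by (induction xs) auto

lemma group_prod_append:
  "set xs \<subseteq> carrier G \<Longrightarrow> set ys \<subseteq> carrier G \<Longrightarrow>
    group_prod G (xs @ ys) = group_prod G xs \<otimes> group_prod G ys"
  by (induction xs) (auto simp: m_assoc)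

lemma word_value_Nil [simp]: "word_value G [] = \<one>"
  and word_value_Cons [simp]:
    "word_value G (p # w) = (if fst p then snd p else inv (snd p)) \<otimes> word_value G w"
  by (simp_all add: word_value_def case_prod_unfold)

lemma word_value_closed [simp]:
  "set w \<subseteq> UNIV \<times> carrier G \<Longrightarrow> word_value G w \<in> carrier G"
  by (induction w) auto

lemma word_value_append:
  "set v \<subseteq> UNIV \<times> carrier G \<Longrightarrow> set w \<subseteq> UNIV \<times> carrier G \<Longrightarrow>
    word_value G (v @ w) = word_value G v \<otimes> word_value G w"
  by (induction v) (auto simp: m_assoc)

lemma word_value_inv_word:
  assumes "set w \<subseteq> UNIV \<times> carrier G"
  shows "word_value G (inv_word w) = inv (word_value G w)"
  using assms
proof (induction w)
  case (Cons p w)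
  then have "word_value G (inv_word (p # w)) = word_value G (inv_word w) \<otimes> word_value G [flip_letter p]"
    using Cons by (subst inv_word_Cons, subst word_value_append) (auto simp: flip_letter_def)
  with Cons show ?case by (auto simp: flip_letter_def inv_mult_group)
qed auto

lemma word_value_power:
  assumes "set w \<subseteq> UNIV \<times> carrier G"
  shows "word_value G (word_power m w) = word_value G w [^] (m :: nat)"
proof (induction m)
  case (Suc m)
  have "set (word_power m w) \<subseteq> UNIV \<times> carrier G"
    using assms by (rule set_word_power_subset)
  with Suc assms show ?case
    unfolding word_power_Suc_right by (simp add: word_value_append)
qed auto

text \<open>No freeness is assumed, so this serves the whole basis as well as subsets of it.
  Products are handled by cancelling the two words.\<close>

lemma ex_reduced_word_of_generate:
  assumes "C \<subseteq> carrier G" "g \<in> generate G C"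
  obtains w where "w \<in> reduced_words C" "word_value G w = g"
proof -
  from assms(2) have "\<exists>w. w \<in> reduced_words C \<and> word_value G w = g"
  proof (induction rule: generate.induct)
    case one
    then show ?case by (intro exI[of _ "[]"]) (auto simp: reduced_words_def)
  next
    case (incl h)
    with assms(1) show ?case by (intro exI[of _ "[(True, h)]"]) (auto simp: reduced_words_def)
  next
    case (inv h)
    with assms(1) show ?case by (intro exI[of _ "[(False, h)]"]) (auto simp: reduced_words_def)
  next
    case (eng g h)
    then obtain v w where vw: "v \<in> reduced_words C" "word_value G v = g"
      "w \<in> reduced_words C" "word_value G w = h" by blast
    then have "reduced_word v" "reduced_word w" by (auto simp: reduced_words_def)
    then obtain a b c where abc: "v = a @ b" "w = inv_word b @ c" "reduced_word (a @ c)"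
      by (rule reduced_word_cancel)
    with vw have sub: "set a \<subseteq> UNIV \<times> C" "set b \<subseteq> UNIV \<times> C" "set c \<subseteq> UNIV \<times> C"
      by (simp_all add: reduced_words_def)
    then have sub': "set a \<subseteq> UNIV \<times> carrier G" "set b \<subseteq> UNIV \<times> carrier G" "set c \<subseteq> UNIV \<times> carrier G"
      using assms(1) by auto
    have "g \<otimes> h = (word_value G a \<otimes> word_value G b) \<otimes> (inv (word_value G b) \<otimes> word_value G c)"
      using vw abc sub' by (auto simp: word_value_append word_value_inv_word)
    also have "\<dots> = word_value G (a @ c)"
      using sub' by (simp add: word_value_append m_assoc)
    finally show ?case using abc sub by (intro exI[of _ "a @ c"]) (auto simp: reduced_words_def)
  qed
  with that show ?thesis by blast
qed

end

locale based_free_group = group G for G (structure) +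
  fixes B
  assumes basis: "free_basis G B"
begin

abbreviation val where "val \<equiv> word_value G"

lemma basis_subset: "B \<subseteq> carrier G"
  using basis by (simp add: free_basis_def)

lemma set_subset_carrier: "set w \<subseteq> UNIV \<times> B \<Longrightarrow> set w \<subseteq> UNIV \<times> carrier G"
  using basis_subset by auto

lemma reduced_words_subset_carrier: "w \<in> reduced_words B \<Longrightarrow> set w \<subseteq> UNIV \<times> carrier G"
  by (auto simp: reduced_words_def dest: set_subset_carrier)

lemma val_closed: "w \<in> reduced_words B \<Longrightarrow> val w \<in> carrier G"
  by (intro word_value_closed reduced_words_subset_carrier)

lemma val_neq_one: "w \<in> reduced_words B \<Longrightarrow> w \<noteq> [] \<Longrightarrow> val w \<noteq> \<one>"
  using basis by (simp add: free_basis_def reduced_words_def)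

text \<open>Cancelling \<open>inv_word v\<close> against \<open>w\<close> leaves a reduced word
  \<open>a @ c\<close> of value \<open>\<one>\<close>. Freeness makes it empty, and then both words
  equal \<open>inv_word b\<close>.\<close>

lemma inj_on_val: "inj_on val (reduced_words B)"
proof (rule inj_onI)
  fix v w assume vw: "v \<in> reduced_words B" "w \<in> reduced_words B" "val v = val w"
  then have "reduced_word (inv_word v)" "reduced_word w"
    by (auto simp: reduced_words_def)
  then obtain a b c where abc: "inv_word v = a @ b" "w = inv_word b @ c" "reduced_word (a @ c)"
    by (rule reduced_word_cancel)
  have v: "v = inv_word b @ inv_word a"
    using abc(1) by (simp add: inv_word_eq_iff)
  have sub: "set a \<subseteq> UNIV \<times> B" "set b \<subseteq> UNIV \<times> B" "set c \<subseteq> UNIV \<times> B"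
    using vw(1,2) unfolding v abc(2) reduced_words_def
    by simp_all
  note sub' = sub[THEN set_subset_carrier]
  have "inv (val b) \<otimes> inv (val a) = inv (val b) \<otimes> val c"
    using vw(3) sub' unfolding v abc(2) by (simp add: word_value_append word_value_inv_word)
  then have "val c = inv (val a)" using sub' by simp
  then have "val (a @ c) = \<one>"
    using sub' by (simp add: word_value_append)
  moreover have "a @ c \<in> reduced_words B"
    using sub abc by (auto simp: reduced_words_def)
  ultimately have "a @ c = []" using val_neq_one by blast
  with v abc show "v = w" by simp
qed

lemma val_image: "val ` reduced_words B = carrier G"
proof
  show "carrier G \<subseteq> val ` reduced_words B"
  proof
    fix g assume "g \<in> carrier G"
    then have "g \<in> generate G B" using basis by (simp add: free_basis_def)
    then show "g \<in> val ` reduced_words B"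
      using ex_reduced_word_of_generate[OF basis_subset] by (metis imageI)
  qed
qed (auto simp: val_closed)

definition nf where "nf = the_inv_into (reduced_words B) val"

lemma nf_val [simp]: "w \<in> reduced_words B \<Longrightarrow> nf (val w) = w"
  unfolding nf_def by (rule the_inv_into_f_f[OF inj_on_val])

lemma val_nf [simp]: "g \<in> carrier G \<Longrightarrow> val (nf g) = g"
  unfolding nf_def by (rule f_the_inv_into_f[OF inj_on_val]) (simp add: val_image)

lemma nf_mem: "g \<in> carrier G \<Longrightarrow> nf g \<in> reduced_words B"
  by (metis imageE nf_val val_image)

lemma nf_one: "nf \<one> = []"
  using nf_val[of "[]"] by (simp add: reduced_words_def)

lemma nf_inv: "g \<in> carrier G \<Longrightarrow> nf (inv g) = inv_word (nf g)"
proof -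
  assume g: "g \<in> carrier G"
  have mem: "inv_word (nf g) \<in> reduced_words B"
    using nf_mem[OF g] by (simp add: reduced_words_def)
  have "val (inv_word (nf g)) = inv g"
    using g by (simp add: word_value_inv_word reduced_words_subset_carrier nf_mem)
  with nf_val[OF mem] show ?thesis by simp
qed

lemma nf_mult:
  assumes "g \<in> carrier G" "h \<in> carrier G"
  obtains a b c where "nf g = a @ b" "nf h = inv_word b @ c" "nf (g \<otimes> h) = a @ c"
proof -
  have gh: "nf g \<in> reduced_words B" "nf h \<in> reduced_words B"
    using assms nf_mem by auto
  then have "reduced_word (nf g)" "reduced_word (nf h)" by (auto simp: reduced_words_def)
  then obtain a b c where abc: "nf g = a @ b" "nf h = inv_word b @ c" "reduced_word (a @ c)"
    by (rule reduced_word_cancel)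
  have sub: "set a \<subseteq> UNIV \<times> B" "set b \<subseteq> UNIV \<times> B" "set c \<subseteq> UNIV \<times> B"
    using gh unfolding abc reduced_words_def by simp_all
  note sub' = sub[THEN set_subset_carrier]
  have "g \<otimes> h = val (nf g) \<otimes> val (nf h)" using assms by simp
  also have "\<dots> = (val a \<otimes> val b) \<otimes> (inv (val b) \<otimes> val c)"
    unfolding abc using sub' by (simp add: word_value_append word_value_inv_word)
  also have "\<dots> = val (a @ c)"
    using sub' by (simp add: word_value_append m_assoc)
  finally have "nf (g \<otimes> h) = a @ c"
    using sub abc by (auto simp: reduced_words_def)
  with abc that show ?thesis by blast
qed

text \<open>The cancelled piece \<open>b\<close> contributes to \<open>g\<close> and, with opposite
  sign, to \<open>h\<close>. Each of the three concatenations costs at most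
  \<open>length u\<close>.\<close>

lemma word_brooks_mult:
  assumes "g \<in> carrier G" "h \<in> carrier G" "u \<noteq> []"
  shows "\<bar>word_brooks u (nf (g \<otimes> h)) - word_brooks u (nf g) - word_brooks u (nf h)\<bar> \<le> 3 * int (length u)"
proof -
  obtain a b c where "nf g = a @ b" "nf h = inv_word b @ c" "nf (g \<otimes> h) = a @ c"
    using nf_mult[OF assms(1,2)] .
  then show ?thesis
    using word_brooks_append[of u a b] word_brooks_append[of u "inv_word b" c]
      word_brooks_append[of u a c] word_brooks_inv_word[OF assms(3), of b]
    by simp
qed

text \<open>Free groups are torsion-free: \<open>h\<close> is conjugate to the value of a nonempty
  cyclically reduced \<open>w\<close>, whose powers are reduced words of distinct lengths.\<close>

lemma inj_nat_pow:
  assumes "h \<in> carrier G" "h \<noteq> \<one>"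
  shows "inj (\<lambda>m::nat. h [^] m)"
proof -
  have mem: "nf h \<in> reduced_words B" using assms nf_mem by auto
  then obtain c w where cw: "nf h = c @ w @ inv_word c" "reduced_word (w @ w)"
    using reduced_word_cyclic_core by (auto simp: reduced_words_def)
  then have sub: "set c \<subseteq> UNIV \<times> B" "set w \<subseteq> UNIV \<times> B"
    using mem by (auto simp: reduced_words_def)
  have sub': "set c \<subseteq> UNIV \<times> carrier G" "set w \<subseteq> UNIV \<times> carrier G"
    using sub[THEN set_subset_carrier] by blast+
  have h: "h = val c \<otimes> val w \<otimes> inv (val c)"
    using val_nf[OF assms(1)] sub' unfolding cw
    by (simp add: word_value_append word_value_inv_word m_assoc)
  then have "w \<noteq> []" using assms sub' by auto
  have conj: "h [^] m = val c \<otimes> val (word_power m w) \<otimes> inv (val c)" for m :: nat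
  proof (induction m)
    case (Suc m)
    have pow: "set (word_power m w) \<subseteq> UNIV \<times> carrier G" using sub'(2) by (rule set_word_power_subset)
    have "h [^] Suc m = (val c \<otimes> val (word_power m w) \<otimes> inv (val c)) \<otimes> (val c \<otimes> val w \<otimes> inv (val c))"
      using Suc h by simp
    also have "\<dots> = val c \<otimes> val (word_power (Suc m) w) \<otimes> inv (val c)"
      unfolding word_power_Suc_right using sub' pow
      by (simp add: word_value_append m_assoc)
    finally show ?case .
  qed (use sub' in auto)
  have rw: "word_power m w \<in> reduced_words B" for m
    using reduced_word_power[OF cw(2)] set_word_power_subset[OF sub(2)]
    unfolding reduced_words_def by blast
  show ?thesis
  proof (rule injI)
    fix i j :: nat assume "h [^] i = h [^] j"
    then have "val (word_power i w) = val (word_power j w)"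
      unfolding conj using sub' by (simp add: val_closed[OF rw])
    then have "word_power i w = word_power j w" using rw inj_on_val by (auto dest: inj_onD)
    then show "i = j" using \<open>w \<noteq> []\<close> by (metis length_word_power length_0_conv mult_cancel2)
  qed
qed


section \<open>Branches of the Cayley tree and their intersection with an almost invariant
  set\<close>

definition cylinder where "cylinder p = {w \<in> reduced_words B. \<exists>v. w = p @ v}"

lemma cylinder_decomp:
  "cylinder p \<subseteq> insert p (\<Union>x\<in>UNIV \<times> B. cylinder (p @ [x]))"
proof
  fix w assume "w \<in> cylinder p"
  then obtain v where w: "w \<in> reduced_words B" "w = p @ v" by (auto simp: cylinder_def)
  show "w \<in> insert p (\<Union>x\<in>UNIV \<times> B. cylinder (p @ [x]))"
  proof (cases v)
    case (Cons x v')
    with w have "x \<in> UNIV \<times> B" by (auto simp: reduced_words_def)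
    moreover have "w \<in> cylinder (p @ [x])" using w Cons by (auto simp: cylinder_def)
    ultimately show ?thesis by blast
  qed (use w in auto)
qed

text \<open>The branch is connected: every vertex is reached from \<open>p\<close> by appending
  letters without leaving the branch, and no such edge crosses the boundary of
  \<open>A\<close>.\<close>

lemma cylinder_constant:
  assumes "\<And>w x. w \<in> cylinder p \<Longrightarrow> x \<in> UNIV \<times> B \<Longrightarrow> val w \<otimes> val [x] \<in> A \<longleftrightarrow> val w \<in> A"
    and "w \<in> cylinder p"
  shows "val w \<in> A \<longleftrightarrow> val p \<in> A"
proof -
  have "p @ v \<in> reduced_words B \<Longrightarrow> val (p @ v) \<in> A \<longleftrightarrow> val p \<in> A" for v
  proof (induction v rule: rev_induct)
    case (snoc x v)
    then have mem: "p @ v \<in> reduced_words B" "x \<in> UNIV \<times> B"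
      using reduced_word_append[of "p @ v" "[x]"] by (simp_all add: reduced_words_def)
    from mem(2) have "set [x] \<subseteq> UNIV \<times> B" by simp
    then have "val ((p @ v) @ [x]) = val (p @ v) \<otimes> val [x]"
      by (rule word_value_append[OF reduced_words_subset_carrier[OF mem(1)] set_subset_carrier])
    moreover have "p @ v \<in> cylinder p" using mem(1) unfolding cylinder_def by blast
    ultimately show ?case
      using assms(1)[OF _ mem(2)] snoc.IH[OF mem(1)] by (metis append_assoc)
  qed simp
  with assms(2) show ?thesis by (auto simp: cylinder_def)
qed

lemma ex_separating_branches:
  assumes "finite B" "A \<subseteq> carrier G" "infinite A" "infinite (carrier G - A)"
    and coboundary: "\<And>s. s \<in> carrier G \<Longrightarrow> finite {g \<in> carrier G. (g \<otimes> s \<in> A) \<noteq> (g \<in> A)}"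
  obtains p a b where "p @ [a] \<in> reduced_words B" "p @ [b] \<in> reduced_words B"
    "finite {w \<in> cylinder (p @ [a]). val w \<in> A}" "finite {w \<in> cylinder (p @ [b]). val w \<notin> A}" "a \<noteq> b"
proof -
  define mixed where "mixed p \<longleftrightarrow>
    infinite {w \<in> cylinder p. val w \<in> A} \<and> infinite {w \<in> cylinder p. val w \<notin> A}" for p
  \<comment> \<open>These are the vertices at which some edge of the tree crosses between
    \<open>A\<close> and its complement.\<close>
  define D where "D = (\<Union>x\<in>UNIV \<times> B. {w \<in> reduced_words B. (val w \<otimes> val [x] \<in> A) \<noteq> (val w \<in> A)})"
  have finite_preimage: "finite {w \<in> reduced_words B. P (val w)}" if "finite {g \<in> carrier G. P g}" for P
  proof (rule finite_imageD)
    show "finite (val ` {w \<in> reduced_words B. P (val w)})"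
      by (rule finite_subset[OF _ that]) (auto simp: val_closed)
    show "inj_on val {w \<in> reduced_words B. P (val w)}"
      using inj_on_val by (rule inj_on_subset) auto
  qed
  have "finite D"
    unfolding D_def
  proof (intro finite_UN_I finite_preimage coboundary)
    show "finite (UNIV \<times> B :: (bool \<times> 'a) set)" using assms(1) by simp
  qed (use basis_subset in auto)
  then obtain N where N: "\<And>w. w \<in> D \<Longrightarrow> length w < N"
    using finite_nat_set_iff_bounded[of "length ` D"] by auto
  \<comment> \<open>A branch beyond a longer \<open>p\<close> contains no vertex of
    \<open>D\<close>, so membership in \<open>A\<close> is constant on it.\<close>
  have mixed_bound: "length p \<le> N" if "mixed p" for p
  proof (rule ccontr)
    assume "\<not> length p \<le> N"
    then have "w \<notin> D" if "w \<in> cylinder p" for w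
      using N[of w] that by (auto simp: cylinder_def)
    then have "val w \<in> A \<longleftrightarrow> val p \<in> A" if "w \<in> cylinder p" for w
      using cylinder_constant[OF _ that, of A] by (auto simp: D_def cylinder_def)
    then have "{w \<in> cylinder p. val w \<in> A} = {} \<or> {w \<in> cylinder p. val w \<notin> A} = {}"
      by blast
    then have "finite {w \<in> cylinder p. val w \<in> A} \<or> finite {w \<in> cylinder p. val w \<notin> A}"
      by (elim disjE) (simp_all only: finite.emptyI simp_thms)
    with that show False unfolding mixed_def by blast
  qed
  \<comment> \<open>The branch beyond the empty word is the whole tree.\<close>
  have "mixed []"
  proof -
    have "infinite {w \<in> cylinder []. P (val w)}" if "infinite {g \<in> carrier G. P g}" for P
    proof
      assume "finite {w \<in> cylinder []. P (val w)}"
      moreover have "g \<in> val ` {w \<in> cylinder []. P (val w)}" if "g \<in> carrier G" "P g" for g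
        using that nf_mem by (intro image_eqI[of _ _ "nf g"]) (auto simp: cylinder_def)
      ultimately show False using \<open>infinite {g \<in> carrier G. P g}\<close>
        by (metis (mono_tags, lifting) finite_imageI finite_subset mem_Collect_eq subsetI)
    qed
    from this[of "\<lambda>g. g \<in> A"] this[of "\<lambda>g. g \<notin> A"] show ?thesis
      using assms(2-4) unfolding mixed_def set_diff_eq by (simp add: inf.absorb2 flip: Int_def)
  qed
  then have "\<exists>p. mixed p \<and> (\<forall>q. mixed q \<longrightarrow> length q \<le> length p)"
    using mixed_bound by (intro ex_has_greatest_nat[where b = "Suc N"]) (auto simp: less_Suc_eq_le)
  then obtain p where p: "mixed p" "\<And>q. mixed q \<Longrightarrow> length q \<le> length p"
    by blast
  \<comment> \<open>Apart from \<open>p\<close> itself, the branch is a finite union of the branches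
    one letter further out, so one of these inherits infinitely many vertices.\<close>
  have branch: "\<exists>x. infinite {w \<in> cylinder (p @ [x]). P w}" if "infinite {w \<in> cylinder p. P w}" for P
  proof (rule ccontr)
    assume "\<nexists>x. infinite {w \<in> cylinder (p @ [x]). P w}"
    then have "finite (\<Union>x\<in>UNIV \<times> B. {w \<in> cylinder (p @ [x]). P w})"
      using assms(1) by (intro finite_UN_I) auto
    then have "finite (insert p (\<Union>x\<in>UNIV \<times> B. {w \<in> cylinder (p @ [x]). P w}))"
      by simp
    moreover have "{w \<in> cylinder p. P w} \<subseteq> insert p (\<Union>x\<in>UNIV \<times> B. {w \<in> cylinder (p @ [x]). P w})"
      using cylinder_decomp[of p] by blast
    ultimately have "finite {w \<in> cylinder p. P w}" by (rule rev_finite_subset)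
    with that show False ..
  qed
  have inf: "infinite {w \<in> cylinder p. val w \<notin> A}" "infinite {w \<in> cylinder p. val w \<in> A}"
    using p(1) by (simp_all add: mixed_def)
  from branch[OF inf(1)] obtain a where a: "infinite {w \<in> cylinder (p @ [a]). val w \<notin> A}" ..
  from branch[OF inf(2)] obtain b where b: "infinite {w \<in> cylinder (p @ [b]). val w \<in> A}" ..
  \<comment> \<open>Maximality of \<open>p\<close> turns infinitude on one side of \<open>A\<close>
    into finiteness on the other.\<close>
  have not_mixed: "\<not> mixed (p @ [x])" for x using p(2)[of "p @ [x]"] by auto
  have mem: "p @ [x] \<in> reduced_words B" if inf: "infinite {w \<in> cylinder (p @ [x]). P w}" for x P
  proof -
    from inf have "{w \<in> cylinder (p @ [x]). P w} \<noteq> {}" by (rule infinite_imp_nonempty)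
    then obtain v where "(p @ [x]) @ v \<in> reduced_words B" by (auto simp: cylinder_def)
    then show ?thesis
      using reduced_word_append[of "p @ [x]" v] by (simp add: reduced_words_def)
  qed
  show ?thesis
  proof (rule that)
    show "finite {w \<in> cylinder (p @ [a]). val w \<in> A}"
      using a not_mixed[of a] by (auto simp: mixed_def)
    show "finite {w \<in> cylinder (p @ [b]). val w \<notin> A}"
      using b not_mixed[of b] by (auto simp: mixed_def)
    with a show "a \<noteq> b" by blast
  qed (rule mem[OF a], rule mem[OF b])
qed

text \<open>The ray from \<open>p\<close> that spells \<open>(x r)\<^sup>\<infinity>\<close> stays at bounded distance from the orbit of
  \<open>p d\<^sup>-\<^sup>1\<close> under right multiplication by the powers of \<open>h\<close>, and membership in \<open>A\<close> is constant along
  that orbit.\<close>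

lemma limit_side:
  assumes A: "A \<subseteq> carrier G" "\<And>s. s \<in> carrier G \<Longrightarrow> finite {g \<in> carrier G. (g \<otimes> s \<in> A) \<noteq> (g \<in> A)}"
    and H: "subgroup H G" "\<And>g h. g \<in> carrier G \<Longrightarrow> h \<in> H \<Longrightarrow> g \<otimes> h \<in> A \<longleftrightarrow> g \<in> A"
    and r: "x # r \<in> reduced_words B" "reduced_word ((x # r) @ x # r)"
    and p: "p @ [x] \<in> reduced_words B"
    and h: "h \<in> H" "d \<in> carrier G" "h = d \<otimes> val (x # r) \<otimes> inv d"
    and fin: "finite {w \<in> cylinder (p @ [x]). (val w \<in> A) \<noteq> Q}"
  shows "val p \<otimes> inv d \<in> A \<longleftrightarrow> Q"
proof -
  let ?r = "x # r" and ?g = "val p \<otimes> inv d"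
  \<comment> \<open>At least one copy of the period is needed for the word to begin with
    \<open>p @ [x]\<close>.\<close>
  let ?w = "\<lambda>m. p @ word_power (Suc m) ?r"
  have p': "p \<in> reduced_words B" using p by (auto simp: reduced_words_def reduced_word_append)
  have w: "?w m \<in> cylinder (p @ [x])" for m
  proof -
    have "set (word_power (Suc m) ?r) \<subseteq> UNIV \<times> B"
      using r(1) by (intro set_word_power_subset) (auto simp: reduced_words_def)
    moreover have "reduced_word (p @ word_power (Suc m) ?r)"
      using reduced_word_power[OF r(2), of "Suc m"] p
      by (auto simp: reduced_word_append reduced_words_def)
    ultimately show ?thesis using p' by (auto simp: cylinder_def reduced_words_def)
  qed
  have pow_H: "h [^] k \<in> H" for k :: nat
    by (induction k) (simp_all add: subgroup.one_closed[OF H(1)] subgroup.m_closed[OF H(1)] h(1))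
  have inj_w: "inj ?w"
  proof (rule injI)
    fix i j assume "?w i = ?w j"
    then have "length (?w i) = length (?w j)" by (rule arg_cong)
    then have "Suc i * length ?r = Suc j * length ?r"
      by (simp only: length_append length_word_power add_left_cancel)
    then show "i = j" by (simp only: mult_cancel2) simp
  qed
  have hc: "h \<in> carrier G" "val p \<in> carrier G" "val ?r \<in> carrier G"
    using h H(1) p' r(1) by (auto simp: val_closed subgroup.mem_carrier simp del: word_value_Cons)
  have pow: "val p \<otimes> val ?r [^] m = ?g \<otimes> h [^] m \<otimes> d" for m :: nat
  proof (induction m)
    case (Suc m)
    have "val p \<otimes> val ?r [^] Suc m = (val p \<otimes> val ?r [^] m) \<otimes> val ?r"
      using hc by (simp add: m_assoc del: word_value_Cons)
    also have "\<dots> = (?g \<otimes> h [^] m \<otimes> d) \<otimes> val ?r" by (simp only: Suc)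
    also have "\<dots> = ?g \<otimes> h [^] Suc m \<otimes> d"
      using hc h(2) unfolding nat_pow_Suc
      by (subst (2) h(3)) (simp add: m_assoc del: word_value_Cons)
    finally show ?case .
  qed (use hc h in \<open>simp add: m_assoc\<close>)
  have val_w: "val (?w m) = ?g \<otimes> h [^] Suc m \<otimes> d" for m
  proof -
    have "val (?w m) = val p \<otimes> val (word_power (Suc m) ?r)"
      using r(1) by (intro word_value_append reduced_words_subset_carrier[OF p'] set_word_power_subset
          reduced_words_subset_carrier)
    also have "val (word_power (Suc m) ?r) = val ?r [^] Suc m"
      by (rule word_value_power[OF reduced_words_subset_carrier[OF r(1)]])
    finally show ?thesis by (simp only: pow)
  qed
  have "inj (\<lambda>m. ?g \<otimes> h [^] Suc m)"
  proof (rule injI)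
    fix i j assume "?g \<otimes> h [^] Suc i = ?g \<otimes> h [^] Suc j"
    then have "val (?w i) = val (?w j)" by (simp only: val_w)
    then have "?w i = ?w j"
      using w[of i] w[of j] inj_on_val unfolding cylinder_def by (blast dest: inj_onD)
    with inj_w show "i = j" by (blast dest: injD)
  qed
  \<comment> \<open>Only finitely many \<open>m\<close> are bad: those where the shift by
    \<open>d\<close> changes membership in \<open>A\<close>, and those where the ray meets the
    exceptional part of the branch. Any other \<open>m\<close> decides the side.\<close>
  then have "finite {m. ?g \<otimes> h [^] Suc m \<in> {g \<in> carrier G. (g \<otimes> d \<in> A) \<noteq> (g \<in> A)}}"
    using A(2)[OF h(2)] by (intro finite_vimageI[unfolded vimage_def])
  moreover have "finite {m. ?w m \<in> {w \<in> cylinder (p @ [x]). (val w \<in> A) \<noteq> Q}}"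
    using fin inj_w by (intro finite_vimageI[unfolded vimage_def])
  ultimately obtain m where
    "m \<notin> {m. ?g \<otimes> h [^] Suc m \<in> {g \<in> carrier G. (g \<otimes> d \<in> A) \<noteq> (g \<in> A)}} \<union>
      {m. ?w m \<in> {w \<in> cylinder (p @ [x]). (val w \<in> A) \<noteq> Q}}"
    using ex_new_if_finite[OF infinite_UNIV_nat finite_UnI] by blast
  then have "?g \<otimes> h [^] Suc m \<notin> {g \<in> carrier G. (g \<otimes> d \<in> A) \<noteq> (g \<in> A)}"
    "?w m \<notin> {w \<in> cylinder (p @ [x]). (val w \<in> A) \<noteq> Q}"
    by blast+
  moreover have "?g \<otimes> h [^] Suc m \<in> carrier G" using hc h(2) by simp
  ultimately have "?g \<otimes> h [^] Suc m \<in> A \<longleftrightarrow> Q"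
    using w[of m] val_w[of m] by auto
  moreover have "?g \<otimes> h [^] Suc m \<in> A \<longleftrightarrow> ?g \<in> A"
    using hc h(2) by (intro H(2) pow_H) simp
  ultimately show ?thesis by blast
qed

end

section \<open>The almost invariant set of a free splitting\<close>

context group
begin

text \<open>Right multiplication by an element of a factor alters only the last syllable of an
  alternating form. The first syllable is affected only if it is also the last, so membership in
  \<open>A\<close> is lost for at most one element.\<close>

lemma ex_almost_invariant_set:
  assumes "is_free_product G H K" "K \<noteq> {\<one>}"
  obtains A where "A \<subseteq> carrier G" "A \<noteq> {}" "\<one> \<notin> A"
    "\<And>g h. g \<in> carrier G \<Longrightarrow> h \<in> H \<Longrightarrow> g \<otimes> h \<in> A \<longleftrightarrow> g \<in> A"
    "\<And>s. s \<in> carrier G \<Longrightarrow> finite {g \<in> carrier G. (g \<otimes> s \<in> A) \<noteq> (g \<in> A)}"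
proof -
  interpret H: subgroup H G using assms by (simp add: is_free_product_def)
  interpret K: subgroup K G using assms by (simp add: is_free_product_def)
  let ?opp = "\<lambda>x y. x \<in> H \<and> y \<in> K \<or> x \<in> K \<and> y \<in> H"
  define alt where "alt xs \<longleftrightarrow> set xs \<subseteq> (H \<union> K) - {\<one>} \<and> successively ?opp xs" for xs
  have alt_neq_one: "group_prod G xs \<noteq> \<one>" if "alt xs" "xs \<noteq> []" for xs
    using assms(1) that by (auto simp: is_free_product_def alt_def)
  have disjoint: "z = \<one>" if "z \<in> H" "z \<in> K" for z
  proof (rule ccontr)
    assume "z \<noteq> \<one>"
    with that have "alt [z, inv z]" by (auto simp: alt_def)
    with alt_neq_one[of "[z, inv z]"] that show False by simp
  qed
  define A where "A = {group_prod G xs | xs. alt xs \<and> xs \<noteq> [] \<and> hd xs \<in> K}"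
  have alt_carrier: "set xs \<subseteq> carrier G" if "alt xs" for xs
    using that by (auto simp: alt_def)
  have "A \<subseteq> carrier G"
    using alt_carrier by (auto simp: A_def)
  \<comment> \<open>The exception is the single syllable \<open>inv s\<close>, which the
    multiplication removes; in all other cases an alternating form starting in \<open>K\<close>
    remains.\<close>
  have step: "g \<otimes> s \<in> A \<or> (s \<in> K \<and> g = inv s)" if "g \<in> A" "s \<in> H \<union> K" for g s
  proof (cases "s = \<one>")
    case True
    with that \<open>A \<subseteq> carrier G\<close> show ?thesis by auto
  next
    case False
    from that(1) obtain xs where xs: "g = group_prod G xs" "alt xs" "xs \<noteq> []" "hd xs \<in> K"
      unfolding A_def by blast
    from xs(3) obtain ys x where "xs = ys @ [x]" by (cases xs rule: rev_cases) simp_all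
    with xs have yx: "g = group_prod G (ys @ [x])" "alt (ys @ [x])" "hd (ys @ [x]) \<in> K"
      by blast+
    have c: "set ys \<subseteq> carrier G" "x \<in> carrier G" "s \<in> carrier G"
      using alt_carrier[OF yx(2)] that(2) by auto
    then have g: "g = group_prod G ys \<otimes> x" by (simp add: yx(1) group_prod_append)
    have x: "x \<in> H \<union> K" "x \<noteq> \<one>" and alt_ys: "alt ys" "ys \<noteq> [] \<Longrightarrow> ?opp (last ys) x"
      using yx(2) by (simp_all add: alt_def successively_append_iff)
    show ?thesis
    proof (cases "?opp x s")
      case True
      with False that(2) have "alt ((ys @ [x]) @ [s])"
        using yx(2) unfolding alt_def successively_append_iff[of _ "ys @ [x]"] by auto
      moreover have "g \<otimes> s = group_prod G ((ys @ [x]) @ [s])"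
        using c g by (simp add: group_prod_append m_assoc)
      moreover have "hd ((ys @ [x]) @ [s]) \<in> K" using yx(3) by (cases ys) auto
      ultimately show ?thesis unfolding A_def by blast
    next
      case same: False
      then have xs: "x \<in> H \<and> s \<in> H \<or> x \<in> K \<and> s \<in> K" using x that(2) by blast
      have gs: "g \<otimes> s = group_prod G ys \<otimes> (x \<otimes> s)" using c g by (simp add: m_assoc)
      show ?thesis
      proof (cases "x \<otimes> s = \<one>")
        case True
        with c have "x = inv s" by (simp add: inv_equality)
        show ?thesis
        proof (cases "ys = []")
          case True
          with yx(3) have "x \<in> K" "g = inv s" using g c \<open>x = inv s\<close> by simp_all
          with xs x disjoint that(2) show ?thesis by blast
        next
          case False
          with yx(3) have "hd ys \<in> K" by simp
          moreover have "g \<otimes> s = group_prod G ys" using gs True c by simp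
          ultimately show ?thesis unfolding A_def using alt_ys(1) False by blast
        qed
      next
        case neq: False
        have "alt (ys @ [x \<otimes> s])"
          using alt_ys xs neq x disjoint unfolding alt_def successively_append_iff by auto
        moreover have "hd (ys @ [x \<otimes> s]) \<in> K"
          using yx(3) xs x disjoint by (cases ys) auto
        moreover have "g \<otimes> s = group_prod G (ys @ [x \<otimes> s])"
          using c gs by (simp add: group_prod_append)
        ultimately show ?thesis unfolding A_def by blast
      qed
    qed
  qed
  have one_notin: "\<one> \<notin> A"
  proof
    assume "\<one> \<in> A"
    then obtain xs where "\<one> = group_prod G xs" "alt xs" "xs \<noteq> []" unfolding A_def by blast
    with alt_neq_one[of xs] show False by simp
  qed
  \<comment> \<open>For \<open>h \<in> H\<close> the exception in \<open>step\<close> would put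
    \<open>h\<close> into both factors, so that \<open>g\<close> would be trivial.\<close>
  have right_H: "g \<otimes> h \<in> A" if "g \<in> A" "h \<in> H" for g h
  proof (rule ccontr)
    assume "g \<otimes> h \<notin> A"
    with step[of g h] that have *: "h \<in> K" "g = inv h" by blast+
    with disjoint[OF that(2)] have "g = \<one>" by simp
    with that(1) one_notin show False by simp
  qed
  \<comment> \<open>This is the outgoing half of the coboundary: the elements that leave
    \<open>A\<close> under \<open>s\<close>.\<close>
  define D where "D s = {g \<in> A. g \<otimes> s \<notin> A}" for s
  have D_factor: "finite (D s)" if "s \<in> H \<union> K" for s
  proof (rule finite_subset)
    show "D s \<subseteq> {inv s}" using step[OF _ that] unfolding D_def by blast
  qed simp
  have "finite (D s)" if "s \<in> generate G (H \<union> K)" for s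
    using that
  proof (induction rule: generate.induct)
    case one
    have "D \<one> = {}" using \<open>A \<subseteq> carrier G\<close> by (auto simp: D_def)
    then show ?case by simp
  next
    case (incl h)
    then show ?case by (rule D_factor)
  next
    case (inv h)
    then show ?case by (intro D_factor) auto
  next
    case (eng s t)
    have st: "s \<in> carrier G" "t \<in> carrier G"
      using eng.hyps generate_in_carrier[of "H \<union> K"] H.subset K.subset by blast+
    \<comment> \<open>An element leaving \<open>A\<close> under the product leaves either under
      \<open>s\<close>, or under \<open>t\<close> after its move by \<open>s\<close>.\<close>
    have "D (s \<otimes> t) \<subseteq> D s \<union> (\<lambda>g. g \<otimes> inv s) ` D t"
    proof
      fix g assume g: "g \<in> D (s \<otimes> t)"
      then have gc: "g \<in> carrier G" using \<open>A \<subseteq> carrier G\<close> by (auto simp: D_def)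
      show "g \<in> D s \<union> (\<lambda>g. g \<otimes> inv s) ` D t"
      proof (cases "g \<otimes> s \<in> A")
        case True
        then have "g \<otimes> s \<in> D t" using g gc st by (simp add: D_def m_assoc)
        moreover have "g = (g \<otimes> s) \<otimes> inv s" using gc st by (simp add: m_assoc)
        ultimately show ?thesis by blast
      qed (use g in \<open>simp add: D_def\<close>)
    qed
    moreover have "finite (D s \<union> (\<lambda>g. g \<otimes> inv s) ` D t)" using eng.IH by simp
    ultimately show ?case by (rule finite_subset)
  qed
  then have finite_D: "finite (D s)" if "s \<in> carrier G" for s
    using that assms(1) by (simp add: is_free_product_def)
  show ?thesis
  proof (rule that[OF \<open>A \<subseteq> carrier G\<close> _ one_notin])
    obtain k where "k \<in> K" "k \<noteq> \<one>" using assms(2) K.one_closed by blast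
    then have "group_prod G [k] \<in> A"
      unfolding A_def alt_def by (intro CollectI exI[of _ "[k]"]) auto
    then show "A \<noteq> {}" by blast
  next
    fix g h assume gh: "g \<in> carrier G" "h \<in> H"
    then have "(g \<otimes> h) \<otimes> inv h = g" by (simp add: m_assoc H.mem_carrier)
    moreover have "inv h \<in> H" using gh(2) by (rule H.m_inv_closed)
    ultimately have "g \<in> A" if "g \<otimes> h \<in> A" using right_H[OF that] by metis
    with right_H[OF _ gh(2)] show "g \<otimes> h \<in> A \<longleftrightarrow> g \<in> A" by blast
  next
    fix s assume s: "s \<in> carrier G"
    \<comment> \<open>The elements that enter \<open>A\<close> under \<open>s\<close> are those
      leaving under \<open>inv s\<close>, shifted back.\<close>
    have "g \<in> D s \<union> (\<lambda>g. g \<otimes> inv s) ` D (inv s)"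
      if g: "g \<in> carrier G" "(g \<otimes> s \<in> A) \<noteq> (g \<in> A)" for g
    proof (cases "g \<in> A")
      case False
      have eq: "(g \<otimes> s) \<otimes> inv s = g" using g s by (simp add: m_assoc)
      with False g have "g \<otimes> s \<in> D (inv s)" by (simp add: D_def)
      then have "(g \<otimes> s) \<otimes> inv s \<in> (\<lambda>g. g \<otimes> inv s) ` D (inv s)" by (rule imageI)
      with eq show ?thesis by simp
    qed (use g in \<open>simp add: D_def\<close>)
    then have "{g \<in> carrier G. (g \<otimes> s \<in> A) \<noteq> (g \<in> A)} \<subseteq> D s \<union> (\<lambda>g. g \<otimes> inv s) ` D (inv s)"
      by blast
    moreover have "finite (D s \<union> (\<lambda>g. g \<otimes> inv s) ` D (inv s))" using finite_D s by simp
    ultimately show "finite {g \<in> carrier G. (g \<otimes> s \<in> A) \<noteq> (g \<in> A)}" by (rule finite_subset)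
  qed
qed

end

section \<open>The Brooks function on separable elements\<close>

context based_free_group
begin

lemma separable_core_misses_pair:
  assumes fin: "finite B" and H: "proper_free_factor G H" and h: "h \<in> H" "h \<noteq> \<one>"
    and core: "nf h = c @ w @ inv_word c" "reduced_word (w @ w)"
  obtains t where "t \<in> reduced_words B" "length t = 2" "\<And>v z. w \<noteq> v @ t @ z"
proof -
  have sub: "subgroup H G" using H by (simp add: proper_free_factor_def proper_nontrivial_subgroup_def)
  have hc: "h \<in> carrier G" using sub h(1) by (rule subgroup.mem_carrier)
  from H obtain K where K: "is_free_product G H K" "K \<noteq> {\<one>}"
    by (auto simp: proper_free_factor_def proper_nontrivial_subgroup_def)
  obtain A where A: "A \<subseteq> carrier G" "A \<noteq> {}" "\<one> \<notin> A"
    "\<And>g h. g \<in> carrier G \<Longrightarrow> h \<in> H \<Longrightarrow> g \<otimes> h \<in> A \<longleftrightarrow> g \<in> A"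
    "\<And>s. s \<in> carrier G \<Longrightarrow> finite {g \<in> carrier G. (g \<otimes> s \<in> A) \<noteq> (g \<in> A)}"
    using ex_almost_invariant_set[OF K] by blast
  have pow_H: "h [^] m \<in> H" for m :: nat
    by (induction m) (simp_all add: subgroup.one_closed[OF sub] subgroup.m_closed[OF sub] h(1))
  have inf_orbit: "infinite (range (\<lambda>m::nat. g \<otimes> h [^] m))" if "g \<in> carrier G" for g
  proof (rule range_inj_infinite, rule injI)
    fix i j :: nat assume "g \<otimes> h [^] i = g \<otimes> h [^] j"
    then have "h [^] i = h [^] j" using that hc by simp
    then show "i = j" using inj_nat_pow[OF hc h(2)] by (blast dest: injD)
  qed
  \<comment> \<open>Right invariance under \<open>H\<close> places a whole orbit of the infinite
    group generated by \<open>h\<close> inside \<open>A\<close>; the orbit of \<open>\<one>\<close>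
    does the same for the complement.\<close>
  have "infinite A"
  proof -
    from A(2) obtain g where g: "g \<in> A" by blast
    then have gc: "g \<in> carrier G" using A(1) by blast
    have "range (\<lambda>m::nat. g \<otimes> h [^] m) \<subseteq> A" using A(4)[OF gc pow_H] g by blast
    with inf_orbit[OF gc] show ?thesis by (rule infinite_super[rotated])
  qed
  moreover have "infinite (carrier G - A)"
  proof -
    have "\<one> \<otimes> h [^] m \<in> carrier G - A" for m :: nat
      using A(4)[OF one_closed pow_H[of m]] A(3) hc by simp
    then have "range (\<lambda>m::nat. \<one> \<otimes> h [^] m) \<subseteq> carrier G - A" by blast
    with inf_orbit[OF one_closed] show ?thesis by (rule infinite_super[rotated])
  qed
  ultimately obtain p a b where pab: "p @ [a] \<in> reduced_words B" "p @ [b] \<in> reduced_words B"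
    "finite {w \<in> cylinder (p @ [a]). val w \<in> A}" "finite {w \<in> cylinder (p @ [b]). val w \<notin> A}" "a \<noteq> b"
    using ex_separating_branches[OF fin A(1) _ _ A(5)] by blast
  \<comment> \<open>The turn at the vertex \<open>p\<close> from the branch through \<open>a\<close>
    to the branch through \<open>b\<close>; it is reduced because
    \<open>a \<noteq> b\<close>.\<close>
  let ?t = "[flip_letter a, b]"
  have t: "?t \<in> reduced_words B"
    using pab by (auto simp: reduced_words_def reduced_word_Cons flip_letter_def)
  have "w \<noteq> v @ ?t @ z" for v z
  proof
    assume w: "w = v @ ?t @ z"
    \<comment> \<open>Cutting \<open>w\<close> inside the turn and rotating gives a period
      \<open>b # r\<close> that starts with \<open>b\<close>, while its inverse
      \<open>a # r'\<close> starts with \<open>a\<close>.\<close>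
    define q where "q = v @ [flip_letter a]"
    define r where "r = z @ q"
    define y where "y = b # z"
    define r' where "r' = inv_word (z @ v) @ [flip_letter b]"
    have w': "w = q @ y" by (simp add: w q_def y_def)
    have yq: "b # r = y @ q" by (simp add: y_def r_def)
    have "nf h \<in> reduced_words B" using hc by (rule nf_mem)
    then have sets: "set c \<subseteq> UNIV \<times> B" "set q \<subseteq> UNIV \<times> B" "set y \<subseteq> UNIV \<times> B"
      unfolding core(1) w' by (simp_all add: reduced_words_def)
    note sets' = sets[THEN set_subset_carrier]
    have "reduced_word (word_power 3 w)" using core(2) by (rule reduced_word_power)
    \<comment> \<open>Two consecutive copies of the rotated word sit inside the cube of
      \<open>w\<close>, which shows that the rotation is again cyclically reduced.\<close>
    moreover have "word_power 3 w = q @ ((b # r) @ (b # r)) @ y"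
      unfolding yq by (simp add: numeral_3_eq_3 w')
    ultimately have rr: "reduced_word ((b # r) @ (b # r))"
      by (simp only: reduced_word_append)
    then have "reduced_word (b # r)" by (simp only: reduced_word_append)
    with sets have r: "b # r \<in> reduced_words B"
      unfolding yq by (simp add: reduced_words_def)
    have inv_r: "a # r' = inv_word (b # r)"
      by (simp add: r'_def r_def q_def)
    have r': "a # r' \<in> reduced_words B"
      using r unfolding inv_r reduced_words_def by (simp only: mem_Collect_eq set_inv_word_subset_iff reduced_inv_word)
    have "inv_word ((b # r) @ (b # r)) = (a # r') @ (a # r')"
      by (simp only: inv_r inv_word_append)
    then have rr': "reduced_word ((a # r') @ (a # r'))"
      using rr reduced_inv_word by metis
    define d where "d = val c \<otimes> val q"
    have d: "d \<in> carrier G" using sets' by (simp add: d_def)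
    have "h = val (c @ (q @ y) @ inv_word c)"
      using val_nf[OF hc] unfolding core(1) w' by simp
    also have "\<dots> = val c \<otimes> val q \<otimes> val y \<otimes> inv (val c)"
      using sets' by (simp add: word_value_append word_value_inv_word m_assoc)
    also have "\<dots> = d \<otimes> val (y @ q) \<otimes> inv d"
      using sets' by (simp add: word_value_append d_def m_assoc inv_mult_group)
    finally have hd: "h = d \<otimes> val (b # r) \<otimes> inv d" by (simp only: yq)
    \<comment> \<open>The translated axis of \<open>h\<close> passes through \<open>p\<close>. Its
      two ends, spelled by \<open>b # r\<close> and by \<open>a # r'\<close>, lie in the two
      branches, and they prescribe opposite sides for the same element.\<close>
    have "val p \<otimes> inv d \<in> A \<longleftrightarrow> True"
      using pab(4) by (intro limit_side[OF A(1,5) sub A(4) r rr pab(2) h(1) d hd]) simp_all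
    moreover have "inv h = d \<otimes> val (a # r') \<otimes> inv d"
      using d val_closed[OF r] reduced_words_subset_carrier[OF r]
      unfolding inv_r hd
      by (simp add: word_value_inv_word inv_mult_group m_assoc del: word_value_Cons inv_word_Cons)
    then have "val p \<otimes> inv d \<in> A \<longleftrightarrow> False"
      using pab(3)
      by (intro limit_side[OF A(1,5) sub A(4) r' rr' pab(1) subgroup.m_inv_closed[OF sub h(1)] d]) simp_all
    ultimately show False by simp
  qed
  with that[OF t] show ?thesis by simp
qed

lemma word_brooks_separable:
  assumes "finite B" "u \<noteq> []" "s \<in> separable_elements G"
    and u: "\<And>t. t \<in> reduced_words B \<Longrightarrow> length t = 2 \<Longrightarrow> \<exists>v z. u = v @ t @ z"
  shows "\<bar>word_brooks u (nf s)\<bar> \<le> 2 * int (length u)"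
proof (cases "s = \<one>")
  case True
  then show ?thesis by (simp add: word_brooks_def nf_one)
next
  case False
  from assms(3) obtain H where H: "proper_free_factor G H" "s \<in> H"
    by (auto simp: separable_elements_def)
  then have sub: "subgroup H G" by (simp add: proper_free_factor_def proper_nontrivial_subgroup_def)
  have sc: "s \<in> carrier G" using sub H(2) by (rule subgroup.mem_carrier)
  have "reduced_word (nf s)" using nf_mem[OF sc] by (simp add: reduced_words_def)
  then obtain c w where core: "nf s = c @ w @ inv_word c" "reduced_word (w @ w)"
    by (rule reduced_word_cyclic_core)
  \<comment> \<open>Stated for all elements of \<open>H\<close> with conjugator \<open>c\<close>, so
    that it applies to \<open>s\<close> and to \<open>inv s\<close>; the latter excludes
    \<open>inv_word u\<close> from \<open>w\<close>.\<close>
  have no_u: "occurrences u w' = 0"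
    if hw: "h \<in> H" "h \<noteq> \<one>" "nf h = c @ w' @ inv_word c" "reduced_word (w' @ w')" for h w'
  proof -
    obtain t where t: "t \<in> reduced_words B" "length t = 2" "\<And>v z. w' \<noteq> v @ t @ z"
      using separable_core_misses_pair[OF assms(1) H(1) hw] by blast
    from u[OF t(1,2)] obtain v z where uvz: "u = v @ t @ z" by blast
    have "w' \<noteq> x @ u @ y" for x y
      using t(3)[of "x @ v" "z @ y"] by (simp add: uvz)
    then show ?thesis by (rule occurrences_eq_0)
  qed
  have "occurrences u w = 0" using no_u[OF H(2) False core] .
  moreover have "occurrences u (inv_word w) = 0"
  proof (rule no_u)
    show "inv s \<in> H" using sub H(2) by (rule subgroup.m_inv_closed)
    show "inv s \<noteq> \<one>" using False sc by simp
    show "nf (inv s) = c @ inv_word w @ inv_word c" using nf_inv[OF sc] core(1) by simp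
    show "reduced_word (inv_word w @ inv_word w)"
      using core(2) reduced_inv_word[of "w @ w"] by simp
  qed
  ultimately have "word_brooks u w = 0"
    by (simp add: word_brooks_def occurrences_inv_word[OF assms(2)])
  then show ?thesis
    using word_brooks_append[of u c "w @ inv_word c"] word_brooks_append[of u w "inv_word c"]
      word_brooks_inv_word[OF assms(2), of c] core(1)
    by simp
qed

section \<open>Primitive elements are separable\<close>

lemma nf_generate:
  assumes "C \<subseteq> B" "g \<in> generate G C"
  shows "nf g \<in> reduced_words C"
proof -
  have "C \<subseteq> carrier G" using assms(1) basis_subset by blast
  then obtain w where w: "w \<in> reduced_words C" "val w = g"
    using assms(2) by (rule ex_reduced_word_of_generate)
  \<comment> \<open>A reduced word over \<open>C\<close> is also one over \<open>B\<close>, so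
    uniqueness identifies it with the normal form.\<close>
  then have "w \<in> reduced_words B" using assms(1) by (auto simp: reduced_words_def)
  with w show ?thesis using nf_val by metis
qed

lemma nf_basis: "x \<in> B \<Longrightarrow> nf x = [(True, x)]"
  using nf_val[of "[(True, x)]"] basis_subset by (auto simp: reduced_words_def)

text \<open>Consecutive syllables are spelled with disjoint sets of basis elements, so concatenating
  their normal forms causes no cancellation and yields a nonempty reduced word.\<close>

lemma is_free_product_basis_split:
  assumes "C \<subseteq> B" "D \<subseteq> B" "C \<inter> D = {}" "C \<union> D = B"
  shows "is_free_product G (generate G C) (generate G D)"
proof -
  let ?H = "generate G C" and ?K = "generate G D"
  let ?opp = "\<lambda>x y. x \<in> ?H \<and> y \<in> ?K \<or> x \<in> ?K \<and> y \<in> ?H"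
  have CD: "C \<subseteq> carrier G" "D \<subseteq> carrier G" using assms basis_subset by auto
  have HK: "?H \<subseteq> carrier G" "?K \<subseteq> carrier G"
    using CD generate_incl by auto
  have nf_ne: "nf z \<noteq> []" if "z \<in> carrier G" "z \<noteq> \<one>" for z
    using val_nf[OF that(1)] that(2) by auto
  have opp: "snd (hd (nf z)) \<noteq> snd (last (nf y))"
    if "?opp y z" "y \<noteq> \<one>" "z \<noteq> \<one>" for y z
  proof -
    have "nf y \<noteq> []" "nf z \<noteq> []" using that HK nf_ne by auto
    then have "last (nf y) \<in> set (nf y)" "hd (nf z) \<in> set (nf z)" by simp_all
    moreover have "nf y \<in> reduced_words C \<and> nf z \<in> reduced_words D \<or>
        nf y \<in> reduced_words D \<and> nf z \<in> reduced_words C"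
      using that(1) nf_generate assms(1,2) by blast
    ultimately have "snd (last (nf y)) \<in> C \<and> snd (hd (nf z)) \<in> D \<or>
        snd (last (nf y)) \<in> D \<and> snd (hd (nf z)) \<in> C"
      by (auto simp: reduced_words_def)
    with assms(3) show ?thesis by auto
  qed
  \<comment> \<open>The clause on the first letter lets the induction check the junction with the
    next syllable in front.\<close>
  have concat: "concat (map nf xs) \<in> reduced_words B \<and>
      val (concat (map nf xs)) = group_prod G xs \<and>
      (xs \<noteq> [] \<longrightarrow> concat (map nf xs) \<noteq> [] \<and> hd (concat (map nf xs)) = hd (nf (hd xs)))"
    if "set xs \<subseteq> (?H \<union> ?K) - {\<one>}" "successively ?opp xs" for xs
    using that
  proof (induction xs)
    case (Cons z xs)
    then have IH: "concat (map nf xs) \<in> reduced_words B"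
      "val (concat (map nf xs)) = group_prod G xs"
      "xs \<noteq> [] \<Longrightarrow> concat (map nf xs) \<noteq> [] \<and> hd (concat (map nf xs)) = hd (nf (hd xs))"
      by (auto simp: successively_Cons)
    have z: "z \<in> carrier G" "z \<noteq> \<one>" using Cons.prems HK by auto
    have "hd (concat (map nf xs)) \<noteq> flip_letter (last (nf z))" if "xs \<noteq> []"
    proof -
      have "hd xs \<in> set xs" using that by simp
      then have "hd xs \<noteq> \<one>" using Cons.prems(1) by auto
      moreover have "?opp z (hd xs)" using Cons.prems(2) that by (simp add: successively_Cons)
      ultimately have "snd (hd (nf (hd xs))) \<noteq> snd (last (nf z))"
        using opp z(2) by blast
      with IH(3)[OF that] show ?thesis by (metis snd_flip_letter)
    qed
    then have "nf z @ concat (map nf xs) \<in> reduced_words B"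
      using IH(1) nf_mem[OF z(1)] by (cases "xs = []") (auto simp: reduced_words_def reduced_word_append)
    moreover have "val (nf z @ concat (map nf xs)) = z \<otimes> group_prod G xs"
      using word_value_append[OF reduced_words_subset_carrier[OF nf_mem[OF z(1)]]
          reduced_words_subset_carrier[OF IH(1)]] IH(2) z(1)
      by (simp only: val_nf)
    ultimately show ?case using nf_ne[OF z] by simp
  qed (simp add: reduced_words_def)
  have "generate G (?H \<union> ?K) = carrier G"
  proof
    show "generate G (?H \<union> ?K) \<subseteq> carrier G" using HK by (intro generate_incl) auto
    have "B \<subseteq> ?H \<union> ?K" using assms(4) by (auto intro: generate.incl)
    then have "generate G B \<subseteq> generate G (?H \<union> ?K)" by (rule mono_generate)
    then show "carrier G \<subseteq> generate G (?H \<union> ?K)" using basis by (simp add: free_basis_def)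
  qed
  moreover have "group_prod G xs \<noteq> \<one>"
    if "xs \<noteq> []" "set xs \<subseteq> (?H \<union> ?K) - {\<one>}" "successively ?opp xs" for xs
    using concat[OF that(2,3)] val_neq_one that(1) by metis
  ultimately show ?thesis
    unfolding is_free_product_def using generate_is_subgroup CD by blast
qed

text \<open>The splitting separates \<open>x\<close> from the rest of the basis; the second element
  \<open>y\<close> makes the complement nontrivial and both factors proper.\<close>

lemma basis_element_separable:
  assumes "x \<in> B" "y \<in> B" "y \<noteq> x"
  shows "x \<in> separable_elements G"
proof -
  let ?H = "generate G {x}" and ?K = "generate G (B - {x})"
  have neq_one: "z \<noteq> \<one>" if "z \<in> B" for z
    using nf_basis[OF that] nf_one by auto
  have mem: "x \<in> ?H" "y \<in> ?K" using assms by (auto intro: generate.incl)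
  have "y \<notin> ?H"
    using nf_generate[of "{x}" y] assms nf_basis[of y] by (auto simp: reduced_words_def)
  moreover have "x \<notin> ?K"
    using nf_generate[of "B - {x}" x] assms nf_basis[of x] by (auto simp: reduced_words_def)
  moreover have "subgroup ?H G" "subgroup ?K G"
    using assms basis_subset by (auto intro!: generate_is_subgroup)
  ultimately have "proper_nontrivial_subgroup G ?H" "proper_nontrivial_subgroup G ?K"
    using mem neq_one assms basis_subset unfolding proper_nontrivial_subgroup_def by blast+
  moreover have "is_free_product G ?H ?K"
    using assms(1) by (intro is_free_product_basis_split) auto
  ultimately have "proper_free_factor G ?H" unfolding proper_free_factor_def by blast
  with mem(1) show ?thesis unfolding separable_elements_def by blast
qed

text \<open>A one-element basis would make the group cyclic, hence abelian, whereas the commutator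
  of \<open>b\<close> and \<open>c\<close> is a nonempty reduced word over \<open>B\<close>. This
  avoids comparing the cardinalities of bases.\<close>

lemma ex_other_basis_element:
  assumes B: "b \<in> B" "c \<in> B" "b \<noteq> c" and B': "free_basis G B'" "x \<in> B'"
  obtains y where "y \<in> B'" "y \<noteq> x"
proof -
  have "B' \<noteq> {x}"
  proof
    assume "B' = {x}"
    with B' have x: "x \<in> carrier G" "generate G {x} = carrier G" by (auto simp: free_basis_def)
    have bc: "b \<in> carrier G" "c \<in> carrier G" using B basis_subset by auto
    then have "b \<in> {x [^] k | k. k \<in> (UNIV :: int set)}" "c \<in> {x [^] k | k. k \<in> (UNIV :: int set)}"
      using generate_pow[OF x(1)] x(2) by simp_all
    then obtain i j :: int where ij: "b = x [^] i" "c = x [^] j"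
      by blast
    then have comm: "b \<otimes> c = c \<otimes> b"
      using x(1) by (simp add: add.commute flip: int_pow_mult)
    let ?w = "[(True, b), (True, c), (False, b), (False, c)]"
    have "val ?w = (b \<otimes> c) \<otimes> (inv b \<otimes> inv c)"
      using bc by (simp add: m_assoc)
    also have "\<dots> = \<one>" unfolding comm using bc by (simp add: m_assoc)
    finally have "val ?w = \<one>" .
    moreover have "?w \<in> reduced_words B"
      using B by (auto simp: reduced_words_def reduced_word_Cons flip_letter_def)
    ultimately show False using val_neq_one[of ?w] by simp
  qed
  with B'(2) that show ?thesis by blast
qed

end

section \<open>Diameter\<close>

text \<open>Along a walk \<open>f\<close> changes by at most \<open>C\<close> per edge, in either
  direction of travel, so large values of \<open>f\<close> occur only far from the identity.\<close>

lemma graph_diameter_Cay_eq_infinity: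
  fixes f :: "'a \<Rightarrow> real"
  assumes "group G" "S \<subseteq> carrier G" "C > 0"
    and lipschitz: "\<And>g s. g \<in> carrier G \<Longrightarrow> s \<in> S \<Longrightarrow> \<bar>f (g \<otimes>\<^bsub>G\<^esub> s) - f g\<bar> \<le> C"
    and unbounded: "\<And>N. \<exists>g\<in>carrier G. f g \<ge> N"
  shows "graph_diameter (Cay G S) = \<infinity>"
proof -
  interpret D: wf_digraph "Cay G S" using assms(1,2) by (rule wf_digraph_Cay)
  interpret P: pair_wf_digraph "mk_symmetric (Cay G S)" ..
  have walk: "\<bar>f v - f u\<bar> \<le> C * real (length p)" if "P.awalk u p v" for u p v
    using that
  proof (induction p arbitrary: u)
    case Nil
    then show ?case by (simp add: P.awalk_Nil_iff)
  next
    case (Cons e p)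
    then have e: "e \<in> parcs (mk_symmetric (Cay G S))" "u = fst e" "P.awalk (snd e) p v"
      by (auto simp: P.awalk_Cons_iff)
    from e(1) obtain g s where "g \<in> carrier G" "s \<in> S"
      "e = (g, g \<otimes>\<^bsub>G\<^esub> s) \<or> e = (g \<otimes>\<^bsub>G\<^esub> s, g)"
      by (auto simp: parcs_mk_symmetric Cay_def)
    with lipschitz[of g s] e(2) have "\<bar>f (snd e) - f u\<bar> \<le> C" by auto
    with Cons.IH[OF e(3)] show ?case by (simp add: algebra_simps)
  qed
  have "ereal r \<le> graph_diameter (Cay G S)" for r
  proof -
    let ?o = "\<one>\<^bsub>G\<^esub>"
    have o: "?o \<in> carrier G" using assms(1) by (simp add: group.is_monoid)
    obtain g where g: "g \<in> carrier G" "f g \<ge> f ?o + C * r" using unbounded by blast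
    have "ereal r \<le> ereal (real (length p))" if "P.awalk ?o p g" for p
    proof -
      have "C * r \<le> C * real (length p)" using walk[OF that] g(2) by linarith
      with assms(3) show ?thesis by simp
    qed
    then have "ereal r \<le> path_dist (Cay G S) ?o g"
      unfolding path_dist_eq[OF D.wf_digraph_axioms] by (intro INF_greatest) auto
    also have "\<dots> \<le> graph_diameter (Cay G S)"
      unfolding graph_diameter_def using o g(1)
      by (intro SUP_upper2[of ?o] SUP_upper) (auto simp: Cay_def)
    finally show ?thesis .
  qed
  then show ?thesis by (rule ereal_top)
qed

theorem corollary1p4:
  fixes F :: "('a, 'm) monoid_scheme" and n :: nat
  assumes "n \<ge> 2" and "free_group_of_rank F n"
  shows "graph_diameter (Cay F (separable_elements F)) = \<infinity> \<and>
         graph_diameter (Cay F (primitive_elements F)) = \<infinity>"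
proof -
  from assms(2) obtain B where "group F" and B: "free_basis F B" "finite B" "card B = n"
    by (auto simp: free_group_of_rank_def)
  interpret based_free_group F B
    using \<open>group F\<close> B(1) by (simp add: based_free_group_def based_free_group_axioms_def)
  obtain b c where bc: "b \<in> B" "c \<in> B" "b \<noteq> c"
    using assms(1) B(3) card_le_Suc0_iff_eq[OF B(2)] by fastforce
  let ?T = "{t \<in> reduced_words B. length t = 2}"
  have "finite ?T"
  proof (rule finite_subset)
    show "?T \<subseteq> {t. set t \<subseteq> UNIV \<times> B \<and> length t = 2}" by (auto simp: reduced_words_def)
    show "finite {t :: (bool \<times> 'a) list. set t \<subseteq> UNIV \<times> B \<and> length t = 2}"
      using B(2) by (intro finite_lists_length_eq) simp
  qed
  moreover have "reduced_word t \<and> set t \<subseteq> UNIV \<times> B" if "t \<in> ?T" for t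
    using that by (simp add: reduced_words_def)
  ultimately obtain u where u: "u \<noteq> []" "reduced_word (u @ u)" "set u \<subseteq> UNIV \<times> B"
    "\<And>t. t \<in> ?T \<Longrightarrow> \<exists>v z. u = v @ t @ z"
    using ex_reduced_word_containing[OF _ _ bc, of ?T] by blast
  define f where "f g = real_of_int (word_brooks u (nf g))" for g
  \<comment> \<open>The constant adds the defect 3 of the quasimorphism to the bound 2 on separable
    elements.\<close>
  have lipschitz: "\<bar>f (g \<otimes>\<^bsub>F\<^esub> s) - f g\<bar> \<le> 5 * real (length u)"
    if "g \<in> carrier F" "s \<in> separable_elements F" for g s
  proof -
    have "\<bar>word_brooks u (nf s)\<bar> \<le> 2 * int (length u)"
      using u(4) by (intro word_brooks_separable B(2) u(1) that(2)) auto
    moreover have "s \<in> carrier F" using that(2) separable_elements_subset[of F] by blast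
    ultimately have "\<bar>word_brooks u (nf (g \<otimes>\<^bsub>F\<^esub> s)) - word_brooks u (nf g)\<bar> \<le> 5 * int (length u)"
      using word_brooks_mult[OF that(1) _ u(1), of s] by linarith
    then show ?thesis unfolding f_def by linarith
  qed
  \<comment> \<open>Powers of \<open>u\<close> are reduced, contain at least \<open>m\<close> copies
    of \<open>u\<close> and no copy of \<open>inv_word u\<close>.\<close>
  have unbounded: "\<exists>g\<in>carrier F. f g \<ge> N" for N
  proof -
    obtain m :: nat where m: "N \<le> real m" using real_arch_simple by blast
    have mem: "word_power m u \<in> reduced_words B"
      using reduced_word_power[OF u(2)] set_word_power_subset[OF u(3)]
      unfolding reduced_words_def by blast
    have "reduced_word u" using u(2) by (simp add: reduced_word_append)
    then have "occurrences (inv_word u) (word_power m u) = 0"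
      using u(1) by (intro occurrences_eq_0 inv_word_not_in_word_power)
    then have "f (val (word_power m u)) \<ge> real m"
      using occurrences_word_power[OF u(1), of m] mem by (simp add: f_def word_brooks_def)
    with m mem val_closed show ?thesis by (meson order_trans)
  qed
  \<comment> \<open>Any set of separable labels admits the same Lipschitz function, which covers the
    primitive elements as well.\<close>
  have infinite: "graph_diameter (Cay F S) = \<infinity>" if S: "S \<subseteq> separable_elements F" for S
  proof (rule graph_diameter_Cay_eq_infinity[OF \<open>group F\<close>, where f = f])
    show "S \<subseteq> carrier F" using S separable_elements_subset[of F] by blast
    show "0 < 5 * real (length u)" using u(1) by simp
  qed (use S lipschitz unbounded in auto)
  have "primitive_elements F \<subseteq> separable_elements F"
  proof
    fix x assume "x \<in> primitive_elements F"
    then obtain B' where B': "free_basis F B'" "x \<in> B'" by (auto simp: primitive_elements_def)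
    then obtain y where y: "y \<in> B'" "y \<noteq> x" using ex_other_basis_element[OF bc] by blast
    interpret B': based_free_group F B'
      using \<open>group F\<close> B'(1) by (simp add: based_free_group_def based_free_group_axioms_def)
    show "x \<in> separable_elements F" using B'.basis_element_separable[OF B'(2) y] .
  qed
  then show ?thesis using infinite by blast
qed

end
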